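(* Let $m\ge1$ and let $L_1,\ldots,L_m\in\mathit{Vect}(n)$ be differential operators of first order in $n$ variables. Then $$L_m\diamond \cdots\diamond L_1=\sum_{\pi\in \Pi(m)} L_{\pi}^\bullet,$$ where $\Pi(m)$ is the set of all set partitions of $[m]=\{1,\ldots,m\}$, and, for $\pi=\{A_1,\dots,A_k\}\in\Pi(m)$, $L_\pi^\bullet=L_{A_1}\bullet\cdots\bullet L_{A_k}$, with $L_A=(L_{i_s}\diamond\cdots\diamond L_{i_2})\circ L_{i_1}$ for a non-empty subset $A=\{i_1<i_2<\cdots<i_s\}\subseteq[m]$ (so $L_A=L_{i_1}$ if $s=1$).
   Context: Let $U$ be the coefficient algebra: a commutative associative unital $\mathbf{C}$-algebra of functions $u=u(x_1,\ldots,x_n)$ with the commuting $\mathbf{C}$-linear derivations $\partial_i=\partial/\partial x_i$, $i=1,\dots,n$ (only this differential-algebra structure is used; for example $U=\mathbf{C}[[x_1,\ldots,x_n]]$). For $\alpha=(\alpha_1,\dots,\alpha_n)\in\mathbf{Z}_0^n$ ($\mathbf{Z}_0$ = non-negative integers) put $\partial^\alpha=\prod_{i=1}^n\partial_i^{\alpha_i}$. $\mathit{Diff}_n$ is the space of differential operators, i.e. finite formal sums $\sum_{\alpha\in\mathbf{Z}_0^n}u_\alpha\partial^\alpha$ with $u_\alpha\in U$ (the free $U$-module on the symbols $\partial^\alpha$). $\mathit{Vect}(n)$ is the subspace of differential operators of first order, i.e. those of the form $\sum_{i=1}^n u_i\partial_i$ with $u_i\in U$. Three bilinear multiplications on $\mathit{Diff}_n$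 are defined on generators by $$u\partial^\alpha \diamond v \partial^\beta=\sum_{\gamma\in \mathbf{Z}^n_0} \binom{\alpha}{\gamma} u\,\partial^\gamma(v)\,\partial^{\alpha+\beta-\gamma},\qquad u\partial^\alpha\circ v\partial^\beta=u\,\partial^\alpha(v)\,\partial^\beta,\qquad u\partial^\alpha \bullet v\partial^\beta= u v\, \partial^{\alpha+\beta},$$ where $\binom{\alpha}{\gamma}=\prod_i\binom{\alpha_i}{\gamma_i}$ (zero unless $\gamma\le\alpha$ componentwise) and $\partial^\alpha(v)$ is the iterated derivative of $v$. The multiplication $\diamond$ (composition) is associative and $\bullet$ is associative and commutative, so the products written without parentheses are well defined. The empty $\diamond$-product is the identity operator $1=\partial^0$. A set partition of $[m]$ is a collection $\{A_1,\dots,A_k\}$ of non-empty pairwise disjoint subsets with union $[m]$. *)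

theory Defs
  imports Complex_Main "HOL-Library.Poly_Mapping" "HOL-Library.Disjoint_Sets"
begin

section \<open>Coefficient algebras\<close>

locale differential_algebra = vector_space scale
  for scale :: "complex \<Rightarrow> 'u::comm_ring_1 \<Rightarrow> 'u" +
  fixes D :: "'n::finite \<Rightarrow> 'u \<Rightarrow> 'u"
  assumes scale_mult_left: "scale c (u * v) = scale c u * v"
    and linear_D: "Vector_Spaces.linear scale scale (D i)"
    and Leibniz: "D i (u * v) = D i u * v + u * D i v"
    and D_commute: "D i (D j u) = D j (D i u)"

type_synonym 'n multi_index = "'n \<Rightarrow>\<^sub>0 nat"

text \<open>The order in which \<^term>\<open>Finite_Set.fold\<close> runs through the
  variables is irrelevant because the derivations commute
  (\<open>mderiv_comp_fun_commute\<close> below).\<close>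

definition mderiv :: "('n::finite \<Rightarrow> 'u \<Rightarrow> 'u) \<Rightarrow> 'n multi_index \<Rightarrow> 'u \<Rightarrow> 'u" where
  "mderiv D \<gamma> v = Finite_Set.fold (\<lambda>i. D i ^^ poly_mapping.lookup \<gamma> i) v UNIV"

definition mbinomial :: "'n::finite multi_index \<Rightarrow> 'n multi_index \<Rightarrow> nat" where
  "mbinomial \<alpha> \<gamma> = (\<Prod>i\<in>UNIV. poly_mapping.lookup \<alpha> i choose poly_mapping.lookup \<gamma> i)"

context differential_algebra
begin

lemma mderiv_comp_fun_commute: "comp_fun_commute (\<lambda>i. D i ^^ poly_mapping.lookup \<gamma> i)"
proof -
  interpret comp_fun_commute D
    by standard (simp add: fun_eq_iff D_commute)
  show ?thesis by (rule comp_fun_commute_funpow)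
qed

lemma D_add: "D i (u + v) = D i u + D i v"
  using linear_D[of i] by (simp add: Vector_Spaces.linear_iff)

lemma mderiv_add: "mderiv D \<gamma> (u + v) = mderiv D \<gamma> u + mderiv D \<gamma> v"
proof -
  interpret comp_fun_commute "\<lambda>i. D i ^^ poly_mapping.lookup \<gamma> i"
    by (rule mderiv_comp_fun_commute)
  have pow: "(D i ^^ k) (x + y) = (D i ^^ k) x + (D i ^^ k) y" for i k x y
    by (induction k) (simp_all add: D_add)
  have "Finite_Set.fold (\<lambda>i. D i ^^ poly_mapping.lookup \<gamma> i) (u + v) S =
      Finite_Set.fold (\<lambda>i. D i ^^ poly_mapping.lookup \<gamma> i) u S + Finite_Set.fold (\<lambda>i. D i ^^ poly_mapping.lookup \<gamma> i) v S"
    if "finite S" for S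
    using that by induction (simp_all add: pow)
  then show ?thesis by (simp add: mderiv_def)
qed

end

lemma finite_multi_index_le:
  "finite {\<gamma> :: 'n::finite multi_index. \<forall>i. poly_mapping.lookup \<gamma> i \<le> poly_mapping.lookup \<alpha> i}" (is "finite ?S")
proof -
  have "poly_mapping.lookup ` ?S \<subseteq> (\<Pi>\<^sub>E i\<in>UNIV. {..poly_mapping.lookup \<alpha> i})"
    by (intro image_subsetI) (simp add: PiE_iff)
  moreover have "finite (\<Pi>\<^sub>E i\<in>(UNIV :: 'n set). {..poly_mapping.lookup \<alpha> i})" by (intro finite_PiE) auto
  ultimately have "finite (poly_mapping.lookup ` ?S)" by (rule finite_subset)
  then show ?thesis
    by (rule finite_imageD) (simp add: inj_on_def poly_mapping.lookup_inject)
qed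


section \<open>Differential operators\<close>

text \<open>The free module on the symbols \<open>\<partial>\<^sup>\<alpha>\<close>: the generator \<open>u \<partial>\<^sup>\<alpha>\<close> is
  \<^term>\<open>Poly_Mapping.single \<alpha> u\<close>.\<close>

type_synonym ('n, 'u) diff_op = "'n multi_index \<Rightarrow>\<^sub>0 'u"

definition id_op :: "('n, 'u::comm_ring_1) diff_op" where
  "id_op = Poly_Mapping.single 0 1"

definition Vect :: "('n::finite, 'u::comm_ring_1) diff_op set" where
  "Vect = {P. \<exists>u. P = (\<Sum>i\<in>UNIV. Poly_Mapping.single (Poly_Mapping.single i 1) (u i))}"

definition extend_bilinear ::
  "('u::comm_ring_1 \<Rightarrow> 'n multi_index \<Rightarrow> 'u \<Rightarrow> 'n multi_index \<Rightarrow> ('n, 'u) diff_op) \<Rightarrow>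
    ('n, 'u) diff_op \<Rightarrow> ('n, 'u) diff_op \<Rightarrow> ('n, 'u) diff_op" where
  "extend_bilinear g P Q =
    (\<Sum>\<alpha>\<in>Poly_Mapping.keys P. \<Sum>\<beta>\<in>Poly_Mapping.keys Q. g (poly_mapping.lookup P \<alpha>) \<alpha> (poly_mapping.lookup Q \<beta>) \<beta>)"

text \<open>The three multiplications \<open>\<diamondop>\<close>, \<open>\<circ>\<close> and \<open>\<bullet>\<close>. In \<open>dcomp\<close> only \<open>\<gamma> \<le> \<alpha>\<close> contribute
  to the sum over all multi-indices, as \<^term>\<open>mbinomial \<alpha> \<gamma> = 0\<close> otherwise.\<close>

definition dcomp ::
  "('n::finite \<Rightarrow> 'u \<Rightarrow> 'u) \<Rightarrow> ('n, 'u::comm_ring_1) diff_op \<Rightarrow> ('n, 'u) diff_op \<Rightarrow> ('n, 'u) diff_op" where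
  "dcomp D = extend_bilinear (\<lambda>u \<alpha> v \<beta>.
    \<Sum>\<gamma>\<in>{\<gamma>. \<forall>i. poly_mapping.lookup \<gamma> i \<le> poly_mapping.lookup \<alpha> i}.
      Poly_Mapping.single (\<alpha> + \<beta> - \<gamma>) (of_nat (mbinomial \<alpha> \<gamma>) * u * mderiv D \<gamma> v))"

definition dact ::
  "('n::finite \<Rightarrow> 'u \<Rightarrow> 'u) \<Rightarrow> ('n, 'u::comm_ring_1) diff_op \<Rightarrow> ('n, 'u) diff_op \<Rightarrow> ('n, 'u) diff_op" where
  "dact D = extend_bilinear (\<lambda>u \<alpha> v \<beta>. Poly_Mapping.single \<beta> (u * mderiv D \<alpha> v))"

definition dbullet ::
  "('n, 'u::comm_ring_1) diff_op \<Rightarrow> ('n, 'u) diff_op \<Rightarrow> ('n, 'u) diff_op" where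
  "dbullet = extend_bilinear (\<lambda>u \<alpha> v \<beta>. Poly_Mapping.single (\<alpha> + \<beta>) (u * v))"

text \<open>\<open>extend_bilinear\<close> is the bi-additive extension of a map on generators that is
  additive in both coefficients, as it is for each of the three multiplications.\<close>

lemma extend_bilinear_superset:
  assumes "\<And>\<alpha> v \<beta>. g 0 \<alpha> v \<beta> = 0" "\<And>u \<alpha> \<beta>. g u \<alpha> 0 \<beta> = 0"
    and "finite A" "Poly_Mapping.keys P \<subseteq> A" "finite B" "Poly_Mapping.keys Q \<subseteq> B"
  shows "extend_bilinear g P Q = (\<Sum>\<alpha>\<in>A. \<Sum>\<beta>\<in>B. g (poly_mapping.lookup P \<alpha>) \<alpha> (poly_mapping.lookup Q \<beta>) \<beta>)"
proof -
  have "extend_bilinear g P Q = (\<Sum>\<alpha>\<in>Poly_Mapping.keys P. \<Sum>\<beta>\<in>B. g (poly_mapping.lookup P \<alpha>) \<alpha> (poly_mapping.lookup Q \<beta>) \<beta>)"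
    unfolding extend_bilinear_def using assms
    by (intro sum.cong refl sum.mono_neutral_left) (auto simp: in_keys_iff)
  also have "\<dots> = (\<Sum>\<alpha>\<in>A. \<Sum>\<beta>\<in>B. g (poly_mapping.lookup P \<alpha>) \<alpha> (poly_mapping.lookup Q \<beta>) \<beta>)"
    using assms by (intro sum.mono_neutral_left) (auto simp: in_keys_iff)
  finally show ?thesis .
qed

lemma extend_bilinear_single:
  assumes "\<And>\<alpha> v \<beta>. g 0 \<alpha> v \<beta> = 0" "\<And>u \<alpha> \<beta>. g u \<alpha> 0 \<beta> = 0"
  shows "extend_bilinear g (Poly_Mapping.single \<alpha> u) (Poly_Mapping.single \<beta> v) = g u \<alpha> v \<beta>"
  by (subst extend_bilinear_superset[where g = g, OF assms, where A = "{\<alpha>}" and B = "{\<beta>}"]) auto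

lemma extend_bilinear_add_left:
  assumes "\<And>u u' \<alpha> v \<beta>. g (u + u') \<alpha> v \<beta> = g u \<alpha> v \<beta> + g u' \<alpha> v \<beta>"
    and "\<And>u \<alpha> v v' \<beta>. g u \<alpha> (v + v') \<beta> = g u \<alpha> v \<beta> + g u \<alpha> v' \<beta>"
  shows "extend_bilinear g (P + P') Q = extend_bilinear g P Q + extend_bilinear g P' Q"
proof -
  have z: "\<And>\<alpha> v \<beta>. g 0 \<alpha> v \<beta> = 0" "\<And>u \<alpha> \<beta>. g u \<alpha> 0 \<beta> = 0"
    using assms(1)[of 0 0] assms(2)[of _ _ 0 0] by simp_all
  note sup = extend_bilinear_superset[where g = g, OF z, where A = "Poly_Mapping.keys P \<union> Poly_Mapping.keys P'" and B = "Poly_Mapping.keys Q"]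
  show ?thesis
    by (subst (1 2 3) sup) (use keys_add[of P P'] in \<open>auto simp: lookup_add assms sum.distrib\<close>)
qed

lemma extend_bilinear_add_right:
  assumes "\<And>u u' \<alpha> v \<beta>. g (u + u') \<alpha> v \<beta> = g u \<alpha> v \<beta> + g u' \<alpha> v \<beta>"
    and "\<And>u \<alpha> v v' \<beta>. g u \<alpha> (v + v') \<beta> = g u \<alpha> v \<beta> + g u \<alpha> v' \<beta>"
  shows "extend_bilinear g P (Q + Q') = extend_bilinear g P Q + extend_bilinear g P Q'"
proof -
  have z: "\<And>\<alpha> v \<beta>. g 0 \<alpha> v \<beta> = 0" "\<And>u \<alpha> \<beta>. g u \<alpha> 0 \<beta> = 0"
    using assms(1)[of 0 0] assms(2)[of _ _ 0 0] by simp_all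
  note sup = extend_bilinear_superset[where g = g, OF z, where A = "Poly_Mapping.keys P" and B = "Poly_Mapping.keys Q \<union> Poly_Mapping.keys Q'"]
  show ?thesis
    by (subst (1 2 3) sup) (use keys_add[of Q Q'] in \<open>auto simp: lookup_add assms sum.distrib\<close>)
qed

context differential_algebra
begin

lemma mderiv_zero: "mderiv D \<gamma> 0 = 0"
  using mderiv_add[of \<gamma> 0 0] by simp

lemma dcomp_single:
  "dcomp D (Poly_Mapping.single \<alpha> u) (Poly_Mapping.single \<beta> v) =
    (\<Sum>\<gamma>\<in>{\<gamma>. \<forall>i. poly_mapping.lookup \<gamma> i \<le> poly_mapping.lookup \<alpha> i}.
      Poly_Mapping.single (\<alpha> + \<beta> - \<gamma>) (of_nat (mbinomial \<alpha> \<gamma>) * u * mderiv D \<gamma> v))"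
  unfolding dcomp_def by (subst extend_bilinear_single) (simp_all add: mderiv_zero)

lemma dact_single:
  "dact D (Poly_Mapping.single \<alpha> u) (Poly_Mapping.single \<beta> v) =
    Poly_Mapping.single \<beta> (u * mderiv D \<alpha> v)"
  unfolding dact_def by (subst extend_bilinear_single) (simp_all add: mderiv_zero)

end

lemma dbullet_eq_times:
  fixes P Q :: "('n, 'u::comm_ring_1) diff_op"
  shows "dbullet P Q = P * Q"
proof -
  have expand: "R = (\<Sum>\<alpha>\<in>Poly_Mapping.keys R. Poly_Mapping.single \<alpha> (poly_mapping.lookup R \<alpha>))"
    for R :: "('n, 'u) diff_op"
    by (rule poly_mapping_eqI)
      (auto simp: lookup_sum lookup_single when_def in_keys_iff)
  have "P * Q = (\<Sum>\<alpha>\<in>Poly_Mapping.keys P. Poly_Mapping.single \<alpha> (poly_mapping.lookup P \<alpha>)) *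
      (\<Sum>\<beta>\<in>Poly_Mapping.keys Q. Poly_Mapping.single \<beta> (poly_mapping.lookup Q \<beta>))"
    by (rule arg_cong2[where f = "(*)", OF expand expand])
  also have "\<dots> = dbullet P Q"
    by (simp add: dbullet_def extend_bilinear_def sum_product mult_single)
  finally show ?thesis by simp
qed

global_interpretation bullet: comm_monoid_set dbullet id_op
  defines dbullet_prod = bullet.F
  by standard (simp_all add: dbullet_eq_times id_op_def mult_ac)


section \<open>Iterated products\<close>

text \<open>\<open>dcomp_list D [P\<^sub>1, \<dots>, P\<^sub>k] = P\<^sub>1 \<diamondop> \<dots> \<diamondop> P\<^sub>k\<close>, bracketed to the right, with
  the identity operator as the empty product.\<close>

definition dcomp_list ::
  "('n::finite \<Rightarrow> 'u \<Rightarrow> 'u) \<Rightarrow> ('n, 'u::comm_ring_1) diff_op list \<Rightarrow> ('n, 'u) diff_op" where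
  "dcomp_list D Ps = foldr (dcomp D) Ps id_op"

text \<open>\<open>L\<^sub>A = (L\<^bsub>i\<^sub>s\<^esub> \<diamondop> \<dots> \<diamondop> L\<^bsub>i\<^sub>2\<^esub>) \<circ> L\<^bsub>i\<^sub>1\<^esub>\<close> for \<open>A = {i\<^sub>1 < \<dots> < i\<^sub>s}\<close> with \<open>s \<ge> 1\<close>.\<close>

definition block_op ::
  "('n::finite \<Rightarrow> 'u \<Rightarrow> 'u) \<Rightarrow> (nat \<Rightarrow> ('n, 'u::comm_ring_1) diff_op) \<Rightarrow> nat set \<Rightarrow> ('n, 'u) diff_op" where
  "block_op D L A = (let xs = sorted_list_of_set A in
    dact D (dcomp_list D (map L (rev (tl xs)))) (L (hd xs)))"

definition partition_op ::
  "('n::finite \<Rightarrow> 'u \<Rightarrow> 'u) \<Rightarrow> (nat \<Rightarrow> ('n, 'u::comm_ring_1) diff_op) \<Rightarrow> nat set set \<Rightarrow> ('n, 'u) diff_op" where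
  "partition_op D L \<pi> = dbullet_prod (block_op D L) \<pi>"

end

theory Submission
  imports Defs
begin

text \<open>
  For a vector field \<open>L\<close> the Leibniz rule reduces composition to
  \<open>L \<diamondop> P = L \<bullet> P + L \<circ> P\<close> (\<open>dcomp_Vect\<close>), and \<open>P \<mapsto> L \<circ> P\<close> is a derivation of the
  commutative algebra of differential operators under \<open>\<bullet>\<close> (\<open>dact_Vect_times\<close>).

  The theorem follows by induction on the number \<open>m\<close> of factors. Multiply the expansion
  for \<open>L\<^sub>m \<diamondop> \<dots> \<diamondop> L\<^sub>1\<close> by \<open>L = L\<^bsub>m+1\<^esub>\<close> on the left. In the summand of a partition \<open>\<pi>\<close>, the
  term \<open>L \<bullet> L\<^sub>\<pi>\<close> belongs to the partition that adjoins \<open>{m+1}\<close> to \<open>\<pi>\<close> as a new block, while the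
  derivation \<open>L \<circ> -\<close> turns \<open>L\<^sub>\<pi>\<close> into the sum, over the blocks \<open>A\<close> of \<open>\<pi>\<close>, of the products in
  which \<open>L\<^sub>A\<close> is replaced by \<open>L \<circ> L\<^sub>A\<close>. Since \<open>L \<circ> (P \<circ> Q) = (L \<diamondop> P) \<circ> Q\<close>
  (\<open>dact_dcomp_Vect\<close>), this replacement is \<open>L\<^bsub>A \<union> {m+1}\<^esub>\<close>. Every partition of \<open>[m+1]\<close> arises
  from exactly one partition of \<open>[m]\<close> in exactly one of these ways
  (\<open>sum_partition_on_insert\<close>).
\<close>

section \<open>Partitions of a set with one more element\<close>

lemma partition_on_block_disjnt:
  assumes "partition_on A \<pi>" "B \<in> \<pi>"
  shows "disjnt B (\<Union>(\<pi> - {B}))"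
  using assms by (fastforce simp: partition_on_def disjoint_def disjnt_iff)

lemma partition_on_remove_block:
  assumes "partition_on A \<pi>" "B \<in> \<pi>"
  shows "partition_on (A - B) (\<pi> - {B})" "B \<subseteq> A" "B \<noteq> {}"
proof -
  have "insert B (\<pi> - {B}) = \<pi>" using assms(2) by blast
  then show "partition_on (A - B) (\<pi> - {B})" "B \<subseteq> A" "B \<noteq> {}"
    using partition_on_insert[OF partition_on_block_disjnt[OF assms], of A] assms(1) by simp_all
qed

lemma partition_on_extend_block:
  assumes "partition_on A \<pi>" "x \<notin> A" "B \<in> \<pi>"
  shows "partition_on (insert x A) (insert (insert x B) (\<pi> - {B}))"
proof -
  have "insert x A - insert x B = A - B" using assms(2) by auto
  moreover have "x \<notin> \<Union>(\<pi> - {B})" using assms(1,2) by (auto simp: partition_on_def)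
  then have "disjnt (insert x B) (\<Union>(\<pi> - {B}))"
    using partition_on_block_disjnt[OF assms(1,3)] by (simp add: disjnt_insert1)
  ultimately show ?thesis
    using partition_on_remove_block[OF assms(1,3)] by (auto simp: partition_on_insert)
qed

lemma partition_on_shrink_block:
  assumes "partition_on (insert x A) \<pi>" "x \<notin> A" "C \<in> \<pi>" "x \<in> C" "C \<noteq> {x}"
  shows "partition_on A (insert (C - {x}) (\<pi> - {C}))" "C - {x} \<notin> \<pi>"
proof -
  note C = partition_on_remove_block[OF assms(1,3)]
  note disj = partition_on_block_disjnt[OF assms(1,3)]
  have ne: "C - {x} \<noteq> {}" using assms(4,5) by blast
  show "C - {x} \<notin> \<pi>"
  proof
    assume "C - {x} \<in> \<pi>"
    with assms(4) have "C - {x} \<in> \<pi> - {C}" by blast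
    then have "C - {x} \<subseteq> \<Union>(\<pi> - {C})" by (rule Union_upper)
    with disj ne show False unfolding disjnt_def by blast
  qed
  have "A - (C - {x}) = insert x A - C" using assms(2,4) by auto
  moreover have "disjnt (C - {x}) (\<Union>(\<pi> - {C}))"
    using disj by (auto simp: disjnt_iff)
  moreover have "C - {x} \<subseteq> A" using C(2) by auto
  ultimately show "partition_on A (insert (C - {x}) (\<pi> - {C}))"
    using C(1) ne by (simp add: partition_on_insert)
qed

text \<open>A partition of \<open>insert x A\<close> is obtained from a partition \<open>\<pi>\<close> of \<open>A\<close> by putting \<open>x\<close> either
  into a block of its own or into one of the blocks of \<open>\<pi>\<close>.\<close>

lemma sum_partition_on_insert:
  fixes F :: "'a set set \<Rightarrow> 'b::comm_monoid_add"
  assumes "finite A" "x \<notin> A"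
  shows "(\<Sum>\<pi>\<in>{\<pi>. partition_on (insert x A) \<pi>}. F \<pi>) =
    (\<Sum>\<pi>\<in>{\<pi>. partition_on A \<pi>}. F (insert {x} \<pi>) +
      (\<Sum>B\<in>\<pi>. F (insert (insert x B) (\<pi> - {B}))))"
proof -
  let ?S = "{\<pi>. partition_on (insert x A) \<pi>}" and ?T = "{\<pi>. partition_on A \<pi>}"
  let ?e = "\<lambda>(\<pi>, B). insert (insert x B) (\<pi> - {B})"
  have fin_S: "finite ?S" and fin_T: "finite ?T"
    using assms(1) by (simp_all add: finitely_many_partition_on)
  have fin_block: "\<forall>\<pi>\<in>?T. finite \<pi>"
    using assms(1) by (auto intro: finite_elements)
  have fresh: "x \<notin> B" if "partition_on A \<pi>" "B \<in> \<pi>" for \<pi> B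
    using that assms(2) by (auto simp: partition_on_def)
  have "(\<Sum>\<pi>\<in>?S. F \<pi>) = (\<Sum>\<pi>\<in>{\<pi>\<in>?S. {x} \<in> \<pi>}. F \<pi>) + (\<Sum>\<pi>\<in>{\<pi>\<in>?S. {x} \<notin> \<pi>}. F \<pi>)"
    using fin_S by (subst sum.union_disjoint [symmetric]) (auto intro: sum.cong)
  also have "(\<Sum>\<pi>\<in>{\<pi>\<in>?S. {x} \<in> \<pi>}. F \<pi>) = (\<Sum>\<pi>\<in>?T. F (insert {x} \<pi>))"
  proof (rule sum.reindex_bij_witness[where i = "insert {x}" and j = "\<lambda>\<pi>. \<pi> - {{x}}"])
    fix \<pi> assume "\<pi> \<in> {\<pi>\<in>?S. {x} \<in> \<pi>}"
    then have "partition_on (insert x A - {x}) (\<pi> - {{x}})"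
      using partition_on_remove_block(1) by blast
    then show "\<pi> - {{x}} \<in> ?T" using assms(2) by simp
  next
    fix \<pi> assume "\<pi> \<in> ?T"
    then have \<pi>: "partition_on A \<pi>" by simp
    then have "disjnt {x} (\<Union>\<pi>)" using fresh by auto
    then show "insert {x} \<pi> \<in> {\<pi>\<in>?S. {x} \<in> \<pi>}"
      using \<pi> assms(2) by (simp add: partition_on_insert)
    show "insert {x} \<pi> - {{x}} = \<pi>" using fresh[OF \<pi>] by auto
  qed (auto simp: insert_absorb)
  also have "(\<Sum>\<pi>\<in>{\<pi>\<in>?S. {x} \<notin> \<pi>}. F \<pi>) = (\<Sum>p\<in>Sigma ?T (\<lambda>\<pi>. \<pi>). F (?e p))"
  proof -
    have "inj_on ?e (Sigma ?T (\<lambda>\<pi>. \<pi>))"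
    proof (rule inj_onI, clarify)
      fix \<pi> B \<pi>' B'
      assume \<pi>: "partition_on A \<pi>" "B \<in> \<pi>" and \<pi>': "partition_on A \<pi>'" "B' \<in> \<pi>'"
        and eq: "insert (insert x B) (\<pi> - {B}) = insert (insert x B') (\<pi>' - {B'})"
      \<comment> \<open>The enlarged block is the only one that contains \<open>x\<close>.\<close>
      have "insert x B = insert x B'"
        using eq fresh[OF \<pi>'(1)] by (metis DiffD1 insertCI insertE)
      then have B: "B = B'" using fresh[OF \<pi>] fresh[OF \<pi>'] by (simp add: insert_ident)
      moreover have "\<pi> - {B} = \<pi>' - {B'}"
      proof -
        have "insert x B \<notin> \<pi> - {B}" "insert x B \<notin> \<pi>' - {B'}"
          using fresh[OF \<pi>(1)] fresh[OF \<pi>'(1)] by auto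
        then show ?thesis using eq B by (simp add: insert_ident)
      qed
      ultimately show "\<pi> = \<pi>' \<and> B = B'" using \<pi>(2) \<pi>'(2) by blast
    qed
    moreover have "?e ` Sigma ?T (\<lambda>\<pi>. \<pi>) = {\<pi>\<in>?S. {x} \<notin> \<pi>}"
    proof (intro equalityI subsetI)
      fix \<rho> assume "\<rho> \<in> ?e ` Sigma ?T (\<lambda>\<pi>. \<pi>)"
      then obtain \<pi> B where \<pi>: "partition_on A \<pi>" "B \<in> \<pi>" and \<rho>: "\<rho> = insert (insert x B) (\<pi> - {B})"
        by auto
      have "{x} \<noteq> insert x B"
        using fresh[OF \<pi>] partition_on_remove_block(3)[OF \<pi>] by blast
      moreover have "{x} \<notin> \<pi>" using fresh[OF \<pi>(1)] by blast
      ultimately show "\<rho> \<in> {\<pi>\<in>?S. {x} \<notin> \<pi>}"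
        using partition_on_extend_block[OF \<pi>(1) assms(2) \<pi>(2)] by (simp add: \<rho>)
    next
      fix \<rho> assume "\<rho> \<in> {\<pi>\<in>?S. {x} \<notin> \<pi>}"
      then have \<rho>: "partition_on (insert x A) \<rho>" "{x} \<notin> \<rho>" by auto
      then obtain C where C: "C \<in> \<rho>" "x \<in> C" by (auto simp: partition_on_def)
      with \<rho>(2) have "C \<noteq> {x}" by auto
      note shrink = partition_on_shrink_block[OF \<rho>(1) assms(2) C this]
      have "insert x (C - {x}) = C" using C(2) by blast
      moreover have "insert (C - {x}) (\<rho> - {C}) - {C - {x}} = \<rho> - {C}"
        using shrink(2) by blast
      ultimately have "\<rho> = ?e (insert (C - {x}) (\<rho> - {C}), C - {x})"
        using C(1) by (simp add: insert_absorb)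
      then show "\<rho> \<in> ?e ` Sigma ?T (\<lambda>\<pi>. \<pi>)"
        by (rule image_eqI) (use shrink(1) in simp)
    qed
    ultimately show ?thesis by (metis (no_types, lifting) sum.reindex_cong)
  qed
  also have "\<dots> = (\<Sum>\<pi>\<in>?T. \<Sum>B\<in>\<pi>. F (insert (insert x B) (\<pi> - {B})))"
    by (subst sum.Sigma[OF fin_T fin_block]) (simp add: case_prod_unfold)
  finally show ?thesis by (simp add: sum.distrib)
qed


section \<open>Calculus of first-order operators\<close>

lemma additive_sum:
  fixes f :: "'a::comm_monoid_add \<Rightarrow> 'b::ab_group_add"
  assumes "\<And>x y. f (x + y) = f x + f y"
  shows "f (sum g S) = (\<Sum>i\<in>S. f (g i))"
proof -
  have "f 0 = 0" using assms[of 0 0] by simp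
  then show ?thesis by (induction S rule: infinite_finite_induct) (simp_all add: assms)
qed

lemma Vect_induct [consumes 1, case_names single add]:
  assumes "L \<in> Vect"
    and single: "\<And>i u. Q (Poly_Mapping.single (Poly_Mapping.single i 1) u)"
    and add: "\<And>P P'. Q P \<Longrightarrow> Q P' \<Longrightarrow> Q (P + P')"
  shows "Q L"
proof -
  obtain u where L: "L = (\<Sum>i\<in>UNIV. Poly_Mapping.single (Poly_Mapping.single i 1) (u i))"
    using assms(1) by (auto simp: Vect_def)
  \<comment> \<open>The zero operator is the multiple \<open>0 \<partial>\<^sub>i\<close> of any generator.\<close>
  have "Q 0" using single[of undefined 0] by simp
  then have "Q (\<Sum>i\<in>S. Poly_Mapping.single (Poly_Mapping.single i 1) (u i))" for S
    by (induction S rule: infinite_finite_induct) (simp_all add: add single del: One_nat_def)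
  then show ?thesis by (simp add: L)
qed

lemma diff_op_induct [case_names single add]:
  fixes P :: "('n, 'u::comm_ring_1) diff_op"
  assumes single: "\<And>\<alpha> u. Q (Poly_Mapping.single \<alpha> u)"
    and add: "\<And>P P'. Q P \<Longrightarrow> Q P' \<Longrightarrow> Q (P + P')"
  shows "Q P"
proof (induction P rule: update_induct)
  case const
  show ?case using single[of 0 0] by simp
next
  case (update P \<alpha> u)
  have "Poly_Mapping.update \<alpha> u P = P + Poly_Mapping.single \<alpha> u"
    using update.hyps
    by (intro poly_mapping_eqI)
      (auto simp: lookup_update lookup_add lookup_single when_def in_keys_iff)
  with update.IH show ?case by (simp add: add single)
qed

lemma dbullet_prod_eq_prod: "dbullet_prod f S = prod f S"
proof -
  have "id_op = (1 :: ('a, 'b) diff_op)" by (simp add: id_op_def)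
  then show ?thesis
    by (induction S rule: infinite_finite_induct) (simp_all add: dbullet_eq_times)
qed

context differential_algebra
begin

lemma mderiv_0: "mderiv D 0 v = v"
proof -
  interpret comp_fun_commute "\<lambda>i. D i ^^ poly_mapping.lookup 0 i"
    by (rule mderiv_comp_fun_commute)
  have "Finite_Set.fold (\<lambda>i. D i ^^ poly_mapping.lookup 0 i) v S = v" if "finite S" for S
    using that
  proof induction
    case (insert x S)
    then show ?case by (subst fold_insert) (simp_all add: id_def)
  qed simp
  then show ?thesis by (simp add: mderiv_def)
qed

lemma mderiv_single_add: "mderiv D (Poly_Mapping.single i 1 + \<beta>) v = D i (mderiv D \<beta> v)"
proof -
  let ?f = "\<lambda>\<beta> i. D i ^^ poly_mapping.lookup \<beta> i"
  interpret A: comp_fun_commute "?f \<beta>"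
    by (rule mderiv_comp_fun_commute)
  interpret B: comp_fun_commute "?f (Poly_Mapping.single i 1 + \<beta>)"
    by (rule mderiv_comp_fun_commute)
  have comm: "(D j ^^ k) (D i w) = D i ((D j ^^ k) w)" for j k w
    by (induction k) (simp_all add: D_commute)
  have "Finite_Set.fold (?f (Poly_Mapping.single i 1 + \<beta>)) v S =
      (if i \<in> S then D i (Finite_Set.fold (?f \<beta>) v S) else Finite_Set.fold (?f \<beta>) v S)"
    if "finite S" for S
    using that
  proof induction
    case (insert x S)
    show ?case
      unfolding A.fold_insert[OF insert.hyps] B.fold_insert[OF insert.hyps] insert.IH
      using insert.hyps by (auto simp: lookup_add lookup_single when_def comm)
  qed simp
  then show ?thesis by (simp add: mderiv_def)
qed

lemma mderiv_single: "mderiv D (Poly_Mapping.single i 1) v = D i v"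
  using mderiv_single_add[of i 0 v] by (simp add: mderiv_0)

lemma dcomp_add_left: "dcomp D (P + P') Q = dcomp D P Q + dcomp D P' Q"
  unfolding dcomp_def
  by (rule extend_bilinear_add_left) 
    (simp_all add: mderiv_add distrib_left distrib_right single_add sum.distrib)

lemma dcomp_add_right: "dcomp D P (Q + Q') = dcomp D P Q + dcomp D P Q'"
  unfolding dcomp_def
  by (rule extend_bilinear_add_right) 
    (simp_all add: mderiv_add distrib_left distrib_right single_add sum.distrib)

lemma dact_add_left: "dact D (P + P') Q = dact D P Q + dact D P' Q"
  unfolding dact_def
  by (rule extend_bilinear_add_left) 
    (simp_all add: mderiv_add distrib_left distrib_right single_add)

lemma dact_add_right: "dact D P (Q + Q') = dact D P Q + dact D P Q'"
  unfolding dact_def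
  by (rule extend_bilinear_add_right) 
    (simp_all add: mderiv_add distrib_left distrib_right single_add)

lemma dcomp_single_single:
  "dcomp D (Poly_Mapping.single (Poly_Mapping.single i 1) u) (Poly_Mapping.single \<beta> v) =
    Poly_Mapping.single (Poly_Mapping.single i 1 + \<beta>) (u * v) + Poly_Mapping.single \<beta> (u * D i v)"
proof -
  let ?e = "Poly_Mapping.single i (1::nat)"
  have below: "{\<gamma>. \<forall>j. poly_mapping.lookup \<gamma> j \<le> poly_mapping.lookup ?e j} = {0, ?e}"
  proof (intro equalityI subsetI)
    fix \<gamma> assume "\<gamma> \<in> {\<gamma>. \<forall>j. poly_mapping.lookup \<gamma> j \<le> poly_mapping.lookup ?e j}"
    then have "poly_mapping.lookup \<gamma> j \<le> poly_mapping.lookup ?e j" for j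
      by blast
    then have le: "poly_mapping.lookup \<gamma> j \<le> (if i = j then 1 else 0)" for j
      unfolding lookup_single when_def .
    have "poly_mapping.lookup \<gamma> j = 0" if "i \<noteq> j" for j
      using le[of j] that by simp
    then have "\<gamma> = Poly_Mapping.single i (poly_mapping.lookup \<gamma> i)"
      by (intro poly_mapping_eqI) (simp add: lookup_single when_def)
    moreover have "poly_mapping.lookup \<gamma> i = 0 \<or> poly_mapping.lookup \<gamma> i = 1"
      using le[of i] by auto
    ultimately show "\<gamma> \<in> {0, ?e}" by (metis insertCI single_zero)
  qed auto
  have "?e \<noteq> 0" by (metis lookup_single_eq lookup_zero zero_neq_one)
  moreover have "mbinomial ?e 0 = 1" "mbinomial ?e ?e = 1"
    by (simp_all add: mbinomial_def)
  ultimately show ?thesis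
    unfolding dcomp_single below
    by (simp add: mderiv_0 mderiv_single del: One_nat_def)
qed

text \<open>For \<open>L = u \<partial>\<^sub>i\<close> only \<open>\<gamma> = 0\<close> and \<open>\<gamma> = \<epsilon>\<^sub>i\<close> contribute to the composition; they give the two
  summands. The product \<open>*\<close> is \<open>\<bullet>\<close>, by \<open>dbullet_eq_times\<close>.\<close>

lemma dcomp_Vect:
  assumes "L \<in> Vect"
  shows "dcomp D L P = L * P + dact D L P"
  using assms
proof (induction rule: Vect_induct)
  case (single i u)
  show ?case
    by (induction P rule: diff_op_induct)
      (simp_all add: dcomp_single_single dact_single mderiv_single mult_single
        dcomp_add_right dact_add_right algebra_simps del: One_nat_def)
next
  case (add P1 P2)
  then show ?case by (simp add: dcomp_add_left dact_add_left algebra_simps)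
qed

text \<open>Applying operators to coefficients (\<open>\<circ>\<close>) turns composition into successive application.
  The case of a first-order left factor suffices here; on generators it is the Leibniz rule for
  \<open>\<partial>\<^sub>i (v \<partial>\<^sup>\<beta>(w))\<close>.\<close>

lemma dact_dcomp_Vect:
  assumes "L \<in> Vect"
  shows "dact D (dcomp D L P) Q = dact D L (dact D P Q)"
  using assms
proof (induction rule: Vect_induct)
  case (single i u)
  show ?case
  proof (induction P rule: diff_op_induct)
    case (single \<beta> v)
    have "mderiv D (\<beta> + Poly_Mapping.single i 1) w = D i (mderiv D \<beta> w)" for w
      using mderiv_single_add[of i \<beta> w] by (simp only: add.commute)
    then show ?case
      by (induction Q rule: diff_op_induct)
        (simp_all add: dcomp_single_single dact_single mderiv_single mderiv_single_add Leibniz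
          dact_add_left dact_add_right algebra_simps flip: single_add del: One_nat_def)
  next
    case (add P1 P2)
    then show ?case by (simp add: dcomp_add_right dact_add_left dact_add_right)
  qed
qed (simp add: dcomp_add_left dact_add_left)

lemma dact_Vect_times:
  assumes "L \<in> Vect"
  shows "dact D L (P * Q) = dact D L P * Q + P * dact D L Q"
  using assms
proof (induction rule: Vect_induct)
  case (single i u)
  show ?case
  proof (induction P rule: diff_op_induct)
    case (single \<beta> v)
    show ?case
      by (induction Q rule: diff_op_induct)
        (simp_all add: dact_single mderiv_single Leibniz mult_single
          dact_add_right algebra_simps flip: single_add del: One_nat_def)
  next
    case (add P1 P2)
    then show ?case by (simp add: dact_add_right algebra_simps)
  qed
qed (simp add: dact_add_left algebra_simps)

text \<open>A derivation of a commutative algebra acts on a finite product by differentiating one factor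
  at a time.\<close>

lemma dact_Vect_prod:
  assumes "L \<in> Vect" "finite S"
  shows "dact D L (prod f S) = (\<Sum>B\<in>S. dact D L (f B) * prod f (S - {B}))"
  using assms(2)
proof induction
  case empty
  show ?case using dact_Vect_times[OF assms(1), of 1 1] by simp
next
  case (insert x S)
  have "prod f (insert x S - {B}) = f x * prod f (S - {B})" if "B \<in> S" for B
  proof -
    have "insert x S - {B} = insert x (S - {B})" using insert.hyps that by auto
    then show ?thesis using insert.hyps by simp
  qed
  then have "(\<Sum>B\<in>S. dact D L (f B) * prod f (insert x S - {B})) =
      f x * (\<Sum>B\<in>S. dact D L (f B) * prod f (S - {B}))"
    by (simp add: sum_distrib_left mult_ac)
  with insert show ?case
    by (simp add: dact_Vect_times[OF assms(1)])
qed


section \<open>Adding one factor\<close>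

lemma block_op_singleton: "block_op D L {x} = L x"
proof -
  have "dact D id_op P = P" for P :: "('n, 'u) diff_op"
    by (induction P rule: diff_op_induct)
      (simp_all add: id_op_def dact_single mderiv_0 dact_add_right del: single_one)
  then show ?thesis by (simp add: block_op_def dcomp_list_def)
qed

text \<open>The largest index of a block labels its leftmost factor, so a new largest index is applied
  last.\<close>

lemma block_op_insert_greater:
  assumes "finite A" "A \<noteq> {}" "\<And>a. a \<in> A \<Longrightarrow> a < x" "L x \<in> Vect"
  shows "block_op D L (insert x A) = dact D (L x) (block_op D L A)"
proof -
  let ?xs = "sorted_list_of_set A"
  have "sorted_list_of_set (insert x A) = ?xs @ [x]"
    using assms(1,3)
    by (subst sorted_list_of_set_unique[symmetric])
      (auto simp: sorted_wrt_append card_insert_if)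
  moreover have "?xs \<noteq> []" using assms(1,2) by simp
  ultimately show ?thesis
    by (simp add: block_op_def Let_def dcomp_list_def dact_dcomp_Vect[OF assms(4)])
qed

text \<open>Composing one summand with a further vector field produces exactly the summands of the
  partitions that restrict to \<open>\<pi>\<close> when the new largest index is removed.\<close>

lemma dcomp_partition_op:
  assumes "finite A" "\<And>a. a \<in> A \<Longrightarrow> a < x" "L x \<in> Vect" "partition_on A \<pi>"
  shows "dcomp D (L x) (partition_op D L \<pi>) = partition_op D L (insert {x} \<pi>) +
    (\<Sum>B\<in>\<pi>. partition_op D L (insert (insert x B) (\<pi> - {B})))"
proof -
  have fin: "finite \<pi>" using assms(1,4) by (rule finite_elements)
  have x: "x \<notin> \<Union>\<pi>" using assms(2,4) by (auto simp: partition_on_def)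
  have "partition_op D L (insert (insert x B) (\<pi> - {B})) =
      dact D (L x) (block_op D L B) * prod (block_op D L) (\<pi> - {B})" if "B \<in> \<pi>" for B
  proof -
    have "B \<subseteq> A" "B \<noteq> {}" using that assms(4) by (auto simp: partition_on_def)
    then have "block_op D L (insert x B) = dact D (L x) (block_op D L B)"
      using assms by (intro block_op_insert_greater) (auto intro: finite_subset)
    moreover have "insert x B \<notin> \<pi> - {B}" using x by auto
    ultimately show ?thesis
      using fin by (simp add: partition_op_def dbullet_prod_eq_prod)
  qed
  moreover have "partition_op D L (insert {x} \<pi>) = L x * partition_op D L \<pi>"
    using fin x block_op_singleton[of L x]
    by (subst (1 2) partition_op_def) (auto simp: dbullet_prod_eq_prod)
  ultimately show ?thesis
    using dact_Vect_prod[OF assms(3) fin, of "block_op D L"]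
    by (simp add: dcomp_Vect[OF assms(3)] partition_op_def dbullet_prod_eq_prod)
qed

end

theorem theorem4:
  fixes scale :: "complex \<Rightarrow> 'u::comm_ring_1 \<Rightarrow> 'u"
    and D :: "'n::finite \<Rightarrow> 'u \<Rightarrow> 'u"
    and L :: "nat \<Rightarrow> ('n, 'u) diff_op"
    and m :: nat
  assumes "differential_algebra scale D"
    and "m \<ge> 1"
    and "\<And>i. i \<in> {1..m} \<Longrightarrow> L i \<in> Vect"
  shows "dcomp_list D (map L (rev [1..<Suc m])) =
    (\<Sum>\<pi>\<in>{\<pi>. partition_on {1..m} \<pi>}. partition_op D L \<pi>)"
proof -
  interpret differential_algebra scale D by fact
  \<comment> \<open>The induction can start at \<open>m = 0\<close>, where both sides are the identity operator.\<close>
  show ?thesis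
    using assms(3)
  proof (induction m)
    case 0
    have "{\<pi>. partition_on {1..0::nat} \<pi>} = {{}}" by (auto simp: partition_on_empty)
    then show ?case by (simp add: dcomp_list_def partition_op_def)
  next
    case (Suc m)
    let ?P = "{\<pi>. partition_on {1..m} \<pi>}"
    have L: "L (Suc m) \<in> Vect" by (rule Suc.prems) simp
    have ivl: "{1..Suc m} = insert (Suc m) {1..m}" by auto
    have "dcomp_list D (map L (rev [1..<Suc (Suc m)])) =
        dcomp D (L (Suc m)) (dcomp_list D (map L (rev [1..<Suc m])))"
      by (simp add: dcomp_list_def)
    also have "dcomp_list D (map L (rev [1..<Suc m])) = (\<Sum>\<pi>\<in>?P. partition_op D L \<pi>)"
      using Suc by simp
    also have "dcomp D (L (Suc m)) \<dots> = (\<Sum>\<pi>\<in>?P. dcomp D (L (Suc m)) (partition_op D L \<pi>))"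
      by (rule additive_sum) (rule dcomp_add_right)
    also have "\<dots> = (\<Sum>\<pi>\<in>?P. partition_op D L (insert {Suc m} \<pi>) +
        (\<Sum>B\<in>\<pi>. partition_op D L (insert (insert (Suc m) B) (\<pi> - {B}))))"
      using L by (intro sum.cong refl dcomp_partition_op[where A = "{1..m}"]) auto
    also have "\<dots> = (\<Sum>\<pi>\<in>{\<pi>. partition_on {1..Suc m} \<pi>}. partition_op D L \<pi>)"
      unfolding ivl by (rule sum_partition_on_insert[symmetric]) auto
    finally show ?case .
  qed
qed

end
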